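(* Let $C_4$ be the cyclic group of order $4$ and let $\lambda(C_4)$ be its superextension. Then $\mathrm{Aut}(\lambda(C_4))\cong C_2\times C_2$, where $\mathrm{Aut}(\lambda(C_4))$ is the group of semigroup automorphisms of $\lambda(C_4)$.
   Context: $C_n$ denotes the cyclic group of order $n$. A family $\mathcal A$ of non-empty subsets of a set $X$ is an upfamily if $A\in\mathcal A$ and $A\subset B\subset X$ imply $B\in\mathcal A$. A family $\mathcal B$ of non-empty subsets of $X$ generates the upfamily $\langle \mathcal B\rangle=\{A\subset X:\exists B\in\mathcal B\ (B\subset A)\}$; we write $\langle B: B\in\mathcal B\rangle$ for it. An upfamily $\mathcal L$ is linked if $A\cap B\neq\emptyset$ for all $A,B\in\mathcal L$. The superextension $\lambda(X)$ is the set of all maximal (with respect to inclusion) linked upfamilies on $X$. For a semigroup $S$ (in particular, a group) with operation $*$, the set $\lambda(S)$ is a semigroup under the (known to be well-defined and associative) operation $$\mathcal A*\mathcal B=\Big\langle\bigcup_{a\in A}a*B_a : A\in\mathcal A,\ \{B_a\}_{a\in A}\subset\mathcal B\Big\rangle .$$ *)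

theory Defs
  imports "HOL-Algebra.Bij" "HOL-Algebra.Elementary_Groups"
begin

definition upfamily :: "'a set \<Rightarrow> 'a set set \<Rightarrow> bool" where
  "upfamily X \<A> \<longleftrightarrow>
     (\<forall>A\<in>\<A>. A \<noteq> {} \<and> A \<subseteq> X) \<and>
     (\<forall>A B. A \<in> \<A> \<longrightarrow> A \<subseteq> B \<longrightarrow> B \<subseteq> X \<longrightarrow> B \<in> \<A>)"

definition upfamily_generated :: "'a set \<Rightarrow> 'a set set \<Rightarrow> 'a set set" where
  "upfamily_generated X \<B> = {A. A \<subseteq> X \<and> (\<exists>B\<in>\<B>. B \<subseteq> A)}"

definition linked :: "'a set set \<Rightarrow> bool" where
  "linked \<L> \<longleftrightarrow> (\<forall>A\<in>\<L>. \<forall>B\<in>\<L>. A \<inter> B \<noteq> {})"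

definition superextension :: "'a set \<Rightarrow> 'a set set set" where
  "superextension X =
     {\<L>. upfamily X \<L> \<and> linked \<L> \<and>
          (\<forall>\<M>. upfamily X \<M> \<longrightarrow> linked \<M> \<longrightarrow> \<L> \<subseteq> \<M> \<longrightarrow> \<M> = \<L>)}"

definition superextension_mult ::
  "('a, 'b) monoid_scheme \<Rightarrow> 'a set set \<Rightarrow> 'a set set \<Rightarrow> 'a set set" where
  "superextension_mult S \<A> \<B> =
     upfamily_generated (carrier S)
       {(\<Union>a\<in>A. a <#\<^bsub>S\<^esub> B a) | A B. A \<in> \<A> \<and> (\<forall>a\<in>A. B a \<in> \<B>)}"

text \<open>The record type requires a unit; we take the principal ultrafilter at the unit of \<open>S\<close>.
  It plays no role in automorphisms: \<^const>\<open>AutoGroup\<close> uses only the carrier and the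
  multiplication, so its elements are the semigroup automorphisms.\<close>

definition superextension_semigroup ::
  "('a, 'b) monoid_scheme \<Rightarrow> 'a set set monoid" where
  "superextension_semigroup S =
     \<lparr>carrier = superextension (carrier S),
      mult = superextension_mult S,
      one = upfamily_generated (carrier S) {{\<one>\<^bsub>S\<^esub>}}\<rparr>"

end

theory Submission
  imports Defs "HOL-Algebra.Multiplicative_Group"
begin

text \<open>Maximal linked upfamilies on \<open>X\<close> are the monotone families that contain exactly one of
  \<open>A\<close> and \<open>X - A\<close> for each \<open>A\<close>, and \<open>C \<in> \<A> * \<B>\<close> iff \<open>{x. x\<inverse>C \<in> \<B>} \<in> \<A>\<close>. On a cyclic group
  of order four with generator \<open>g\<close> there are twelve of them: the translates of the principal
  ultrafilter \<open>e\<close>, of \<open>s = {A. 1 \<in> A, |A| \<ge> 2} \<union> {A. g, g\<^sup>2, g\<^sup>3 \<in> A}\<close>, and of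
  \<open>t = {A. |A \<inter> {g, g\<^sup>2, g\<^sup>3}| \<ge> 2}\<close>. Since \<open>s * s = t * t = s\<close> and \<open>s * t = t * s = t\<close>, the
  superextension is the product of the cyclic group of order four and the group \<open>{s, t}\<close> of order
  two with an external unit \<open>e\<close> adjoined. An automorphism inverts or fixes \<open>g\<close>, fixes \<open>s\<close>, and sends
  \<open>t\<close> to \<open>t\<close> or \<open>g\<^sup>2 * t\<close>; both choices are free.\<close>

section \<open>Maximal linked upfamilies\<close>

text \<open>A set that meets every member can be added together with its supersets, so by maximality
  it is already a member; if \<open>X - A\<close> is not a member, no member avoids
  \<open>A\<close>, so \<open>A\<close> is such a set. Conversely, a larger upfamily than a
  self-dual one contains a set and its complement. For empty \<open>X\<close> the duality clause
  contradicts itself at \<open>A = {}\<close>.\<close>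

lemma superextension_iff_self_dual:
  assumes "X \<noteq> {}"
  shows "L \<in> superextension X \<longleftrightarrow>
    L \<subseteq> Pow X \<and> (\<forall>A B. A \<in> L \<longrightarrow> A \<subseteq> B \<longrightarrow> B \<subseteq> X \<longrightarrow> B \<in> L) \<and>
    (\<forall>A. A \<subseteq> X \<longrightarrow> (A \<in> L \<longleftrightarrow> X - A \<notin> L))"
    (is "_ \<longleftrightarrow> ?sub \<and> ?up \<and> ?dual")
proof
  assume "L \<in> superextension X"
  then have up: "upfamily X L" and linked: "linked L"
    and max: "\<And>M. upfamily X M \<Longrightarrow> linked M \<Longrightarrow> L \<subseteq> M \<Longrightarrow> M = L"
    by (auto simp: superextension_def)
  have nonempty: "B \<noteq> {}" "B \<subseteq> X" if "B \<in> L" for B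
    using that up by (simp_all add: upfamily_def)
  have closed: "C \<in> L" if "B \<in> L" "B \<subseteq> C" "C \<subseteq> X" for B C
    using that up unfolding upfamily_def by blast
  have meets: "A \<in> L" if A: "A \<subseteq> X" "A \<noteq> {}" and m: "\<And>B. B \<in> L \<Longrightarrow> A \<inter> B \<noteq> {}" for A
  proof -
    let ?M = "L \<union> {B. A \<subseteq> B \<and> B \<subseteq> X}"
    have "upfamily X ?M"
      unfolding upfamily_def
    proof (intro conjI ballI allI impI)
      fix B assume "B \<in> ?M"
      then show "B \<noteq> {}" "B \<subseteq> X" using A nonempty[of B] by auto
    next
      fix B C assume "B \<in> ?M" "B \<subseteq> C" "C \<subseteq> X"
      then show "C \<in> ?M" using closed[of B C] by blast
    qed
    moreover have "linked ?M"
      unfolding linked_def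
    proof (intro ballI)
      fix B C assume "B \<in> ?M" "C \<in> ?M"
      moreover have "B \<inter> C \<noteq> {}" if "B \<in> L" "C \<in> L"
        using that linked by (auto simp: linked_def)
      ultimately show "B \<inter> C \<noteq> {}"
        using m[of B] m[of C] A by blast
    qed
    ultimately have "?M = L" by (rule max) blast
    then show ?thesis using A by blast
  qed
  have "X \<in> L"
  proof (rule meets)
    show "X \<inter> B \<noteq> {}" if "B \<in> L" for B
      using nonempty[OF that] by blast
  qed (use assms in auto)
  have ?dual
  proof (intro allI impI iffI)
    fix A assume "A \<subseteq> X" "A \<in> L"
    then show "X - A \<notin> L"
      using linked unfolding linked_def by blast
  next
    fix A assume A: "A \<subseteq> X" "X - A \<notin> L"
    show "A \<in> L"
    proof (rule meets)
      show "A \<noteq> {}" using A(2) \<open>X \<in> L\<close> by force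
      show "A \<inter> B \<noteq> {}" if "B \<in> L" for B
      proof
        assume "A \<inter> B = {}"
        then have "B \<subseteq> X - A" using nonempty[OF that] by blast
        then show False using closed[OF that] A by blast
      qed
    qed (use A in auto)
  qed
  moreover have ?sub using nonempty(2) by blast
  moreover have ?up using closed by blast
  ultimately show "?sub \<and> ?up \<and> ?dual" by blast
next
  assume asm: "?sub \<and> ?up \<and> ?dual"
  then have sub: ?sub and closed: "\<And>A B. A \<in> L \<Longrightarrow> A \<subseteq> B \<Longrightarrow> B \<subseteq> X \<Longrightarrow> B \<in> L"
    and dual: "\<And>A. A \<subseteq> X \<Longrightarrow> A \<in> L \<longleftrightarrow> X - A \<notin> L"
    by blast+
  \<comment> \<open>Monotonicity would bring in \<open>X\<close> as well, the complement of
    \<open>{}\<close>.\<close>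
  have "{} \<notin> L" using closed[of "{}" X] dual[of "{}"] by auto
  then have "upfamily X L"
    using sub closed unfolding upfamily_def by blast
  moreover have "linked L"
    unfolding linked_def
  proof (intro ballI notI)
    fix A B assume "A \<in> L" "B \<in> L" "A \<inter> B = {}"
    moreover from this have "B \<subseteq> X - A" using sub by blast
    ultimately show False using closed[of B "X - A"] dual[of A] sub by blast
  qed
  moreover have "M = L" if M: "upfamily X M" "linked M" "L \<subseteq> M" for M
  proof
    show "M \<subseteq> L"
    proof
      fix A assume "A \<in> M"
      then have "A \<subseteq> X" using M(1) by (simp add: upfamily_def)
      moreover have "X - A \<notin> M"
        using M(2) \<open>A \<in> M\<close> unfolding linked_def by blast
      ultimately show "A \<in> L" using M(3) dual[of A] by blast
    qed
  qed fact
  ultimately show "L \<in> superextension X"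
    unfolding superextension_def by blast
qed

text \<open>A translate of \<open>B a\<close> by \<open>a\<close> lies in \<open>C\<close> iff
  \<open>B a\<close> lies in the preimage of \<open>C\<close> under left multiplication by
  \<open>a\<close>. These preimages are the largest admissible \<open>B a\<close>, and the points
  whose preimage belongs to \<open>\<B>\<close> form the largest admissible
  \<open>A\<close>.\<close>

lemma superextension_mult_eq:
  assumes "upfamily (carrier S) \<A>" "upfamily (carrier S) \<B>"
    and closed: "\<And>x y. x \<in> carrier S \<Longrightarrow> y \<in> carrier S \<Longrightarrow> x \<otimes>\<^bsub>S\<^esub> y \<in> carrier S"
  shows "superextension_mult S \<A> \<B> =
    {C. C \<subseteq> carrier S \<and> {x \<in> carrier S. {y \<in> carrier S. x \<otimes>\<^bsub>S\<^esub> y \<in> C} \<in> \<B>} \<in> \<A>}"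
proof (intro equalityI subsetI)
  have subA: "\<And>A. A \<in> \<A> \<Longrightarrow> A \<subseteq> carrier S"
    and upA: "\<And>A B. A \<in> \<A> \<Longrightarrow> A \<subseteq> B \<Longrightarrow> B \<subseteq> carrier S \<Longrightarrow> B \<in> \<A>"
    and subB: "\<And>A. A \<in> \<B> \<Longrightarrow> A \<subseteq> carrier S"
    and upB: "\<And>A B. A \<in> \<B> \<Longrightarrow> A \<subseteq> B \<Longrightarrow> B \<subseteq> carrier S \<Longrightarrow> B \<in> \<B>"
    using assms unfolding upfamily_def by blast+
  fix C
  {
    assume "C \<in> superextension_mult S \<A> \<B>"
    then obtain A B where AB: "C \<subseteq> carrier S" "A \<in> \<A>" "\<And>a. a \<in> A \<Longrightarrow> B a \<in> \<B>"
      and C: "(\<Union>a\<in>A. a <#\<^bsub>S\<^esub> B a) \<subseteq> C"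
      unfolding superextension_mult_def upfamily_generated_def by blast
    have "{y \<in> carrier S. a \<otimes>\<^bsub>S\<^esub> y \<in> C} \<in> \<B>" if "a \<in> A" for a
      using AB(3)[OF that]
    proof (rule upB)
      show "B a \<subseteq> {y \<in> carrier S. a \<otimes>\<^bsub>S\<^esub> y \<in> C}"
        using C that subB[OF AB(3)[OF that]] by (auto simp: l_coset_def)
    qed auto
    then have "A \<subseteq> {x \<in> carrier S. {y \<in> carrier S. x \<otimes>\<^bsub>S\<^esub> y \<in> C} \<in> \<B>}"
      using subA[OF AB(2)] by blast
    then show "C \<in> {C. C \<subseteq> carrier S \<and> {x \<in> carrier S. {y \<in> carrier S. x \<otimes>\<^bsub>S\<^esub> y \<in> C} \<in> \<B>} \<in> \<A>}"
      using upA[OF AB(2)] AB(1) by auto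
  next
    assume C: "C \<in> {C. C \<subseteq> carrier S \<and> {x \<in> carrier S. {y \<in> carrier S. x \<otimes>\<^bsub>S\<^esub> y \<in> C} \<in> \<B>} \<in> \<A>}"
    let ?B = "\<lambda>x. {y \<in> carrier S. x \<otimes>\<^bsub>S\<^esub> y \<in> C}"
    let ?A = "{x \<in> carrier S. ?B x \<in> \<B>}"
    have "?A \<in> \<A>" "\<forall>a\<in>?A. ?B a \<in> \<B>" using C by auto
    then have "(\<Union>a\<in>?A. a <#\<^bsub>S\<^esub> ?B a) \<in>
      {(\<Union>a\<in>A. a <#\<^bsub>S\<^esub> B a) | A B. A \<in> \<A> \<and> (\<forall>a\<in>A. B a \<in> \<B>)}"
      by (intro CollectI exI[of _ ?A] exI[of _ ?B] conjI refl)
    moreover have "(\<Union>a\<in>?A. a <#\<^bsub>S\<^esub> ?B a) \<subseteq> C" by (auto simp: l_coset_def)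
    ultimately show "C \<in> superextension_mult S \<A> \<B>"
      using C unfolding superextension_mult_def upfamily_generated_def
      by (intro CollectI conjI bexI) auto
  }
qed

section \<open>Transport of automorphism groups\<close>

text \<open>The inner \<open>inv_into A h\<close> and \<open>h\<close> cancel. Restriction to
  \<open>B\<close> keeps conjugates extensional, as elements of \<open>AutoGroup\<close>
  are.\<close>

lemma compose_conjugate:
  assumes h: "bij_betw h A B" and "f \<in> A \<rightarrow> A" "f' \<in> A \<rightarrow> A"
  shows "(\<lambda>y\<in>B. h (compose A f f' (inv_into A h y))) =
    compose B (\<lambda>y\<in>B. h (f (inv_into A h y))) (\<lambda>y\<in>B. h (f' (inv_into A h y)))"
proof
  fix y
  have "inv_into A h y \<in> A" if "y \<in> B"
    using h that by (metis bij_betw_def inv_into_into)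
  moreover have "inv_into A h (h x) = x" "h x \<in> B" if "x \<in> A" for x
    using h that by (auto simp: bij_betw_inv_into_left bij_betw_apply)
  ultimately show "(\<lambda>y\<in>B. h (compose A f f' (inv_into A h y))) y =
    compose B (\<lambda>y\<in>B. h (f (inv_into A h y))) (\<lambda>y\<in>B. h (f' (inv_into A h y))) y"
    using assms by (auto simp: compose_def Pi_iff)
qed

lemma conjugate_in_auto:
  assumes h: "h \<in> iso S T" and f: "f \<in> auto S"
    and closed: "\<And>x y. x \<in> carrier S \<Longrightarrow> y \<in> carrier S \<Longrightarrow> x \<otimes>\<^bsub>S\<^esub> y \<in> carrier S"
  shows "(\<lambda>y\<in>carrier T. h (f (inv_into (carrier S) h y))) \<in> auto T"
proof -
  let ?c = "\<lambda>y\<in>carrier T. h (f (inv_into (carrier S) h y))"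
  have hb: "bij_betw h (carrier S) (carrier T)"
    and hm: "\<And>x y. x \<in> carrier S \<Longrightarrow> y \<in> carrier S \<Longrightarrow> h (x \<otimes>\<^bsub>S\<^esub> y) = h x \<otimes>\<^bsub>T\<^esub> h y"
    using h by (simp_all add: iso_def hom_mult)
  have fb: "bij_betw f (carrier S) (carrier S)"
    and fm: "\<And>x y. x \<in> carrier S \<Longrightarrow> y \<in> carrier S \<Longrightarrow> f (x \<otimes>\<^bsub>S\<^esub> y) = f x \<otimes>\<^bsub>S\<^esub> f y"
    using f by (simp_all add: auto_def Bij_def hom_mult)
  have "bij_betw (h \<circ> (f \<circ> inv_into (carrier S) h)) (carrier T) (carrier T)"
    by (rule bij_betw_trans[OF bij_betw_trans[OF bij_betw_inv_into[OF hb] fb] hb])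
  then have cb: "bij_betw ?c (carrier T) (carrier T)"
    by (subst bij_betw_cong[where g = "h \<circ> (f \<circ> inv_into (carrier S) h)"]) auto
  have ch: "?c (h x) = h (f x)" if "x \<in> carrier S" for x
    using that hb by (auto simp: bij_betw_inv_into_left bij_betw_apply)
  have "?c (u \<otimes>\<^bsub>T\<^esub> v) = ?c u \<otimes>\<^bsub>T\<^esub> ?c v" if uv: "u \<in> carrier T" "v \<in> carrier T" for u v
  proof -
    obtain x y where x: "x \<in> carrier S" "u = h x" and y: "y \<in> carrier S" "v = h y"
      using uv bij_betw_imp_surj_on[OF hb] by (metis imageE)
    have fc: "f x \<in> carrier S" "f y \<in> carrier S"
      using x y fb by (auto simp: bij_betw_apply)
    have "?c (u \<otimes>\<^bsub>T\<^esub> v) = ?c (h (x \<otimes>\<^bsub>S\<^esub> y))"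
      by (simp only: x y hm)
    also have "\<dots> = h (f x) \<otimes>\<^bsub>T\<^esub> h (f y)"
      by (simp only: ch[OF closed[OF x(1) y(1)]] fm[OF x(1) y(1)] hm[OF fc])
    also have "\<dots> = ?c u \<otimes>\<^bsub>T\<^esub> ?c v"
      by (simp only: x y ch)
    finally show ?thesis .
  qed
  then have "?c \<in> hom T T"
    using bij_betw_apply[OF cb] by (intro homI)
  then show ?thesis
    using cb unfolding auto_def Bij_def by blast
qed

lemma carrier_AutoGroup: "carrier (AutoGroup S) = auto S"
  by (simp add: AutoGroup_def)

lemma mult_AutoGroup:
  "f \<in> auto S \<Longrightarrow> f' \<in> auto S \<Longrightarrow> f \<otimes>\<^bsub>AutoGroup S\<^esub> f' = compose (carrier S) f f'"
  by (simp add: AutoGroup_def BijGroup_def auto_def)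

text \<open>Conjugation by \<open>h\<close> respects composition, and conjugation by the inverse of
  \<open>h\<close> undoes it. Semigroups are intended here, so only closure of the multiplication is
  assumed.\<close>

lemma AutoGroup_iso:
  assumes h: "h \<in> iso S T"
    and closed: "\<And>x y. x \<in> carrier S \<Longrightarrow> y \<in> carrier S \<Longrightarrow> x \<otimes>\<^bsub>S\<^esub> y \<in> carrier S"
  shows "AutoGroup S \<cong> AutoGroup T"
proof -
  let ?A = "carrier S" and ?B = "carrier T"
  let ?k = "inv_into ?A h"
  let ?c = "\<lambda>f. \<lambda>y\<in>?B. h (f (?k y))"
  \<comment> \<open>Written as conjugation by \<open>?k\<close>, with \<open>inv_into ?B ?k\<close>
    in the place of \<open>h\<close>, so that \<open>conjugate_in_auto\<close> covers both
    directions.\<close>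
  let ?d = "\<lambda>f. \<lambda>x\<in>?A. ?k (f (inv_into ?B ?k x))"
  have hb: "bij_betw h ?A ?B" using h by (auto simp: iso_def)
  have closedT: "u \<otimes>\<^bsub>T\<^esub> v \<in> ?B" if uv: "u \<in> ?B" "v \<in> ?B" for u v
  proof -
    obtain x y where xy: "x \<in> ?A" "u = h x" "y \<in> ?A" "v = h y"
      using uv bij_betw_imp_surj_on[OF hb] by (metis imageE)
    then have "u \<otimes>\<^bsub>T\<^esub> v = h (x \<otimes>\<^bsub>S\<^esub> y)"
      using h by (auto simp: iso_def hom_def)
    then show ?thesis
      using closed xy hb by (simp add: bij_betw_apply)
  qed
  have k: "?k \<in> iso T S"
  proof -
    have "?k (u \<otimes>\<^bsub>T\<^esub> v) = ?k u \<otimes>\<^bsub>S\<^esub> ?k v" if uv: "u \<in> ?B" "v \<in> ?B" for u v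
    proof -
      obtain x y where "x \<in> ?A" "u = h x" "y \<in> ?A" "v = h y"
        using uv bij_betw_imp_surj_on[OF hb] by (metis imageE)
      moreover from this have "u \<otimes>\<^bsub>T\<^esub> v = h (x \<otimes>\<^bsub>S\<^esub> y)"
        using h by (auto simp: iso_def hom_def)
      ultimately show ?thesis
        using hb closed by (simp add: bij_betw_inv_into_left)
    qed
    then show ?thesis
      using bij_betw_inv_into[OF hb] by (auto simp: iso_def hom_def bij_betw_apply)
  qed
  have kh: "?k (h x) = x" "h x \<in> ?B" "inv_into ?B ?k x = h x" if "x \<in> ?A" for x
    using that hb by (auto simp: bij_betw_inv_into_left bij_betw_apply inv_into_inv_into_eq)
  have hk: "h (?k y) = y" "?k y \<in> ?A" if "y \<in> ?B" for y
    using that hb k by (auto simp: bij_betw_inv_into_right iso_def hom_def)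
  have cauto: "?c f \<in> auto T" if "f \<in> auto S" for f
    using conjugate_in_auto[OF h that closed] .
  have dauto: "?d f \<in> auto S" if "f \<in> auto T" for f
    using conjugate_in_auto[OF k that closedT] .
  have fA: "f \<in> ?A \<rightarrow> ?A" "f \<in> extensional ?A" if "f \<in> auto S" for f
    using that by (auto simp: auto_def hom_def Bij_def)
  have fB: "f \<in> ?B \<rightarrow> ?B" "f \<in> extensional ?B" if "f \<in> auto T" for f
    using that by (auto simp: auto_def hom_def Bij_def)
  have "bij_betw ?c (auto S) (auto T)"
  proof (rule bij_betw_byWitness[where f' = ?d])
    show "\<forall>f\<in>auto S. ?d (?c f) = f"
    proof
      fix f assume "f \<in> auto S"
      note f = fA[OF this]
      show "?d (?c f) = f"
      proof (rule extensionalityI[OF _ f(2)])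
        show "?d (?c f) x = f x" if "x \<in> ?A" for x
          using that funcset_mem[OF f(1) that] by (simp add: kh)
      qed simp
    qed
    show "\<forall>f\<in>auto T. ?c (?d f) = f"
    proof
      fix f assume "f \<in> auto T"
      note f = fB[OF this]
      show "?c (?d f) = f"
      proof (rule extensionalityI[OF _ f(2)])
        show "?c (?d f) y = f y" if "y \<in> ?B" for y
          using that funcset_mem[OF f(1) that] by (simp add: kh hk)
      qed simp
    qed
  qed (use cauto dauto in blast)+
  moreover have "?c \<in> hom (AutoGroup S) (AutoGroup T)"
  proof (rule homI)
    fix f assume "f \<in> carrier (AutoGroup S)"
    then show "?c f \<in> carrier (AutoGroup T)"
      unfolding carrier_AutoGroup by (rule cauto)
  next
    fix f f' assume ff: "f \<in> carrier (AutoGroup S)" "f' \<in> carrier (AutoGroup S)"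
    then show "?c (f \<otimes>\<^bsub>AutoGroup S\<^esub> f') = ?c f \<otimes>\<^bsub>AutoGroup T\<^esub> ?c f'"
      unfolding carrier_AutoGroup
      by (simp only: mult_AutoGroup cauto compose_conjugate[OF hb fA(1) fA(1)])
  qed
  ultimately have "?c \<in> iso (AutoGroup S) (AutoGroup T)"
    unfolding iso_def carrier_AutoGroup by (intro CollectI conjI)
  then show ?thesis
    unfolding is_iso_def by (metis empty_iff)
qed

section \<open>The semigroup $C_4 \times C_2^1$ and its automorphisms\<close>

text \<open>\<open>None\<close> is the external unit \<open>e\<close>, \<open>Some False\<close> is \<open>s\<close> and \<open>Some True\<close> is \<open>t\<close>.\<close>

fun adjoin_mult :: "bool option \<Rightarrow> bool option \<Rightarrow> bool option" where
  "adjoin_mult None l = l"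
| "adjoin_mult (Some x) None = Some x"
| "adjoin_mult (Some x) (Some y) = Some (x \<noteq> y)"

text \<open>The pair \<open>(i, k)\<close> stands for the translate by \<open>g [^] i\<close> of the
  upfamily that \<open>k\<close> names.\<close>

definition model :: "(int \<times> bool option) monoid" where
  "model = \<lparr>carrier = {0..<4} \<times> UNIV,
     mult = \<lambda>(i, k) (j, l). ((i + j) mod 4, adjoin_mult k l),
     one = (0, None)\<rparr>"

text \<open>For \<open>a\<close> and \<open>b\<close> in \<open>{0, 1}\<close>, the sign
  \<open>1 - 2 * a\<close> fixes or inverts the cyclic factor, and \<open>2 * b\<close> shifts
  \<open>Some True\<close> by the element of order two or leaves it.\<close>

definition model_auto :: "int \<times> int \<Rightarrow> int \<times> bool option \<Rightarrow> int \<times> bool option" where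
  "model_auto = (\<lambda>(a, b). \<lambda>(i, k) \<in> {0..<4} \<times> UNIV.
     (((1 - 2 * a) * i + (if k = Some True then 2 * b else 0)) mod 4, k))"

lemma carrier_model: "carrier model = {0, 1, 2, 3} \<times> {None, Some False, Some True}"
proof -
  have "{0..<4::int} = {0, 1, 2, 3}" by auto
  moreover have "(UNIV :: bool option set) = {None, Some False, Some True}"
    by (auto simp: UNIV_option_conv UNIV_bool)
  ultimately show ?thesis by (simp add: model_def)
qed

lemma mult_model: "(i, k) \<otimes>\<^bsub>model\<^esub> (j, l) = ((i + j) mod 4, adjoin_mult k l)"
  by (simp add: model_def)

lemma model_auto_apply:
  "(i, k) \<in> carrier model \<Longrightarrow>
    model_auto (a, b) (i, k) = (((1 - 2 * a) * i + (if k = Some True then 2 * b else 0)) mod 4, k)"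
  by (simp add: model_auto_def model_def)

text \<open>Two factors over \<open>Some True\<close> contribute \<open>4 * b\<close>, which
  vanishes modulo 4, and their product lies over \<open>Some False\<close>. Each map is an
  involution, hence its own inverse.\<close>

lemma model_auto_in_auto:
  assumes "a \<in> {0, 1}" "b \<in> {0, 1}"
  shows "model_auto (a, b) \<in> auto model"
proof -
  let ?f = "model_auto (a, b)"
  have Pi: "?f \<in> carrier model \<rightarrow> carrier model"
    by (auto simp: model_auto_def model_def)
  have "?f (?f x) = x" if "x \<in> carrier model" for x
    using assms that by (auto simp: carrier_model model_auto_apply)
  then have "bij_betw ?f (carrier model) (carrier model)"
    using Pi by (intro bij_betw_byWitness[where f' = ?f]) auto
  moreover have "?f (x \<otimes>\<^bsub>model\<^esub> y) = ?f x \<otimes>\<^bsub>model\<^esub> ?f y"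
    if "x \<in> carrier model" "y \<in> carrier model" for x y
    using assms that by (auto simp: carrier_model model_auto_apply mult_model)
  moreover have "?f \<in> extensional (carrier model)"
    by (simp add: model_auto_def model_def)
  ultimately show ?thesis
    using Pi by (simp add: auto_def Bij_def hom_def)
qed

text \<open>Since \<open>(j, l)\<close> is the product of \<open>(j, None)\<close>, a power of
  \<open>(1, None)\<close>, and \<open>(0, l)\<close>, the images of \<open>(1, None)\<close>,
  \<open>(0, Some False)\<close> and \<open>(0, Some True)\<close> determine
  \<open>f\<close>.\<close>

lemma auto_model_cases:
  assumes f: "f \<in> auto model"
  obtains a b where "a \<in> {0, 1}" "b \<in> {0, 1}" "f = model_auto (a, b)"
proof -
  let ?X = "carrier model"
  let ?m = "\<lambda>(i, k) (j, l). ((i + j) mod 4 :: int, adjoin_mult k l)"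
  have fm: "f (?m x y) = ?m (f x) (f y)" if "x \<in> ?X" "y \<in> ?X" for x y
    using f that by (auto simp: auto_def hom_def model_def)
  have bij: "bij_betw f ?X ?X" and ext: "f \<in> extensional ?X"
    using f by (simp_all add: auto_def Bij_def)
  have fX: "f x \<in> ?X" if "x \<in> ?X" for x using bij that by (rule bij_betw_apply)
  have inj: "f x = f y \<longleftrightarrow> x = y" if "x \<in> ?X" "y \<in> ?X" for x y
    using bij_betw_imp_inj_on[OF bij] that by (simp add: inj_on_eq_iff)
  \<comment> \<open>Only products are known to be preserved, so the unit needs surjectivity: if
    \<open>f x\<close> is the unit, then \<open>f (0, None)\<close> times \<open>f x\<close> equals
    \<open>f x\<close>.\<close>
  have f0: "f (0, None) = (0, None)"
  proof -
    have "(0, None) \<in> f ` ?X"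
      unfolding bij_betw_imp_surj_on[OF bij] by (simp add: carrier_model)
    then obtain x where x: "x \<in> ?X" "f x = (0, None)" by force
    have "?m (0, None) x = x" using x(1) by (auto simp: model_def)
    moreover have "(0, None) \<in> ?X" by (simp add: carrier_model)
    ultimately have "?m (f (0, None)) (0, None) = (0, None)"
      using fm[of "(0, None)" x] x by simp
    then show ?thesis
      using fX[OF \<open>(0, None) \<in> ?X\<close>] by (auto simp: carrier_model)
  qed
  obtain i k where u: "f (1, None) = (i, k)" by fastforce
  obtain p q where v: "f (0, Some False) = (p, q)" by fastforce
  obtain r s where w: "f (0, Some True) = (r, s)" by fastforce
  have range: "i \<in> {0,1,2,3}" "k \<in> {None, Some False, Some True}"
    "p \<in> {0,1,2,3}" "q \<in> {None, Some False, Some True}"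
    "r \<in> {0,1,2,3}" "s \<in> {None, Some False, Some True}"
    using fX[of "(1, None)"] fX[of "(0, Some False)"] fX[of "(0, Some True)"] u v w
    unfolding carrier_model by auto
  note fm = fm[unfolded carrier_model] and inj = inj[unfolded carrier_model]
  have u2: "f (2, None) = ?m (i, k) (i, k)" using fm[of "(1, None)" "(1, None)"] u by simp
  have u3: "f (3, None) = ?m (?m (i, k) (i, k)) (i, k)"
    using fm[of "(2, None)" "(1, None)"] u u2 by simp
  have u4: "f (0, None) = ?m (?m (?m (i, k) (i, k)) (i, k)) (i, k)"
    using fm[of "(3, None)" "(1, None)"] u u3 by simp
  \<comment> \<open>The fourth power of the generator is the unit, and a power of a
    \<open>Some\<close> value is never \<open>None\<close>.\<close>
  have "adjoin_mult (adjoin_mult (adjoin_mult k k) k) k = None"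
    using u4 unfolding f0 by simp
  then have "k = None"
    by (cases k) auto
  \<comment> \<open>An even \<open>i\<close> would send the square of the generator to the
    unit.\<close>
  have "f (2, None) \<noteq> (0, None)"
    using inj[of "(2, None)" "(0, None)"] f0 by simp
  then have i: "i = 1 \<or> i = 3"
    using range(1) unfolding u2 \<open>k = None\<close> by auto
  \<comment> \<open>\<open>(0, Some False)\<close> is the only idempotent other than the
    unit.\<close>
  have "?m (p, q) (p, q) = (p, q)" "(p, q) \<noteq> (0, None)"
    using fm[of "(0, Some False)" "(0, Some False)"] v f0 inj[of "(0, Some False)" "(0, None)"]
    by simp_all
  then have pq: "p = 0" "q = Some False"
    using range(3,4) by auto
  \<comment> \<open>\<open>(2, Some False)\<close> also squares to \<open>(0, Some False)\<close>;
    as it is already taken as a value, two candidates remain for the image of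
    \<open>(0, Some True)\<close>.\<close>
  have f2: "f (2, Some False) = (2, Some False)"
    using fm[of "(2, None)" "(0, Some False)"] u2 i by (auto simp: v pq \<open>k = None\<close>)
  have "?m (r, s) (r, s) = (0, Some False)"
    using fm[of "(0, Some True)" "(0, Some True)"] by (simp add: v w pq)
  moreover have "?m (0, Some False) (r, s) = (r, s)"
    using fm[of "(0, Some False)" "(0, Some True)"] by (simp add: v w pq)
  moreover have "(r, s) \<noteq> (0, Some False)"
    using inj[of "(0, Some True)" "(0, Some False)"] by (simp add: v w pq)
  moreover have "(r, s) \<noteq> (2, Some False)"
    using inj[of "(0, Some True)" "(2, Some False)"] by (simp add: w f2)
  ultimately have rs: "r = 0 \<or> r = 2" "s = Some True"
    using range(5,6) by auto
  define a b :: int where "a = (if i = 1 then 0 else 1)" and "b = (if r = 0 then 0 else 1)"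
  have "f x = model_auto (a, b) x" if "x \<in> ?X" for x
  proof -
    obtain j l where x: "x = (j, l)" by fastforce
    have "j \<in> {0,1,2,3}" "l \<in> {None, Some False, Some True}"
      using that unfolding x carrier_model by auto
    moreover from this have "f (j, l) = ?m (f (j, None)) (f (0, l))"
      using fm[of "(j, None)" "(0, l)"] by auto
    ultimately show ?thesis
      using i pq rs unfolding x model_auto_apply[OF that[unfolded x]] a_def b_def
      by (auto simp: f0 u u2 u3 v w \<open>k = None\<close>)
  qed
  moreover have "f x = model_auto (a, b) x" if "x \<notin> ?X" for x
    using extensional_arb[OF ext that] that by (simp add: model_auto_def model_def split_def)
  ultimately have "f = model_auto (a, b)" by blast
  then show ?thesis using that[of a b] by (auto simp: a_def b_def)
qed

text \<open>Modulo 4 a change of sign does not affect \<open>2 * b\<close>, so under composition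
  signs multiply and shifts add independently: the parameters add modulo 2.\<close>

lemma AutoGroup_model:
  "integer_mod_group 2 \<times>\<times> integer_mod_group 2 \<cong> AutoGroup model"
proof -
  let ?K = "integer_mod_group 2 \<times>\<times> integer_mod_group 2"
  have K: "carrier ?K = {0, 1} \<times> {0, 1}"
    by (auto simp: carrier_integer_mod_group)
  have "inj_on model_auto (carrier ?K)"
  proof (rule inj_onI)
    fix x y assume xy: "x \<in> carrier ?K" "y \<in> carrier ?K" "model_auto x = model_auto y"
    \<comment> \<open>The value at \<open>(1, None)\<close> reveals the sign, the one at
      \<open>(0, Some True)\<close> the shift.\<close>
    from xy(3) have "model_auto x (1, None) = model_auto y (1, None)"
      "model_auto x (0, Some True) = model_auto y (0, Some True)" by simp_all
    with xy(1,2) show "x = y"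
      unfolding K by (auto simp: model_auto_apply carrier_model)
  qed
  moreover have "model_auto ` carrier ?K = auto model"
  proof
    show "auto model \<subseteq> model_auto ` carrier ?K"
      unfolding K by (auto elim!: auto_model_cases)
    show "model_auto ` carrier ?K \<subseteq> auto model"
      unfolding K by (auto intro: model_auto_in_auto)
  qed
  moreover have "model_auto \<in> hom ?K (AutoGroup model)"
  proof (rule homI)
    fix x assume "x \<in> carrier ?K"
    then show "model_auto x \<in> carrier (AutoGroup model)"
      unfolding K carrier_AutoGroup by (auto intro: model_auto_in_auto)
  next
    fix x y assume xy: "x \<in> carrier ?K" "y \<in> carrier ?K"
    have in_auto: "model_auto x \<in> auto model" "model_auto y \<in> auto model"
      using xy unfolding K by (auto intro: model_auto_in_auto)
    have "model_auto (x \<otimes>\<^bsub>?K\<^esub> y) z = compose (carrier model) (model_auto x) (model_auto y) z" for z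
    proof (cases "z \<in> carrier model")
      case True
      then show ?thesis
        using xy unfolding K compose_def
        by (auto simp: model_auto_apply carrier_model)
    next
      case False
      then show ?thesis
        by (cases "x \<otimes>\<^bsub>?K\<^esub> y") (auto simp: model_auto_def compose_def model_def)
    qed
    then show "model_auto (x \<otimes>\<^bsub>?K\<^esub> y) = model_auto x \<otimes>\<^bsub>AutoGroup model\<^esub> model_auto y"
      using in_auto by (simp add: mult_AutoGroup fun_eq_iff)
  qed
  ultimately show "?K \<cong> AutoGroup model"
    by (auto simp: is_iso_def iso_def bij_betw_def carrier_AutoGroup)
qed

section \<open>The twelve maximal linked upfamilies on $C_4$\<close>

text \<open>A subset \<open>A\<close> of the group is read as the sequence \<open>a n \<longleftrightarrow> g [^] n \<in> A\<close>; the template says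
  when \<open>A\<close> belongs to \<open>e\<close>, \<open>s\<close> or \<open>t\<close>.\<close>

fun template :: "bool option \<Rightarrow> (int \<Rightarrow> bool) \<Rightarrow> bool" where
  "template None a \<longleftrightarrow> a 0"
| "template (Some False) a \<longleftrightarrow> a 0 \<and> (a 1 \<or> a 2 \<or> a 3) \<or> a 1 \<and> a 2 \<and> a 3"
| "template (Some True) a \<longleftrightarrow> a 1 \<and> a 2 \<or> a 2 \<and> a 3 \<or> a 1 \<and> a 3"

lemma template_mono:
  "template k a \<Longrightarrow> (\<And>n. a n \<Longrightarrow> b n) \<Longrightarrow> template k b"
  by (induction k a rule: template.induct) (simp; blast)+

text \<open>Each template is a vote of odd total weight, hence without ties: \<open>None\<close>
  lets 0 decide, \<open>Some False\<close> has weights 2, 1, 1, 1, and \<open>Some True\<close> is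
  the majority of 1, 2, 3.\<close>

lemma template_not: "template k (\<lambda>n. \<not> a n) \<longleftrightarrow> \<not> template k a"
  by (induction k a rule: template.induct) (simp; blast)+

text \<open>The nested condition is the product formula written in exponents, so this is the
  multiplication table of the templates.\<close>

lemma template_template:
  assumes "\<And>n. a (n + 4) = a n"
  shows "template k (\<lambda>m. template l (\<lambda>n. a (m + n))) \<longleftrightarrow> template (adjoin_mult k l) a"
proof -
  \<comment> \<open>With \<open>m\<close> and \<open>n\<close> at most 3, the index
    \<open>m + n\<close> reaches 6.\<close>
  have a: "a 4 = a 0" "a 5 = a 1" "a 6 = a 2"
    using assms[of 0] assms[of 1] assms[of 2] by simp_all
  have "k \<in> {None, Some False, Some True}" "l \<in> {None, Some False, Some True}"
    by (auto simp: not_Some_eq)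
  then show ?thesis
    by (elim insertE emptyE; simp add: a; argo)
qed

text \<open>By self-duality a family is known from its answers on one set of each complementary
  pair. Apart from the pair of the empty and the full set, the four singletons and the three
  two-element sets through 0 represent all pairs.\<close>

lemma template_inject:
  assumes x: "(i, k) \<in> carrier model" and y: "(j, l) \<in> carrier model"
    and eq: "\<And>c. template k (\<lambda>m. c ((i + m) mod 4)) \<longleftrightarrow> template l (\<lambda>m. c ((j + m) mod 4))"
  shows "i = j \<and> k = l"
proof -
  define e where "e i k c \<longleftrightarrow> template k (\<lambda>m. c ((i + m) mod 4))" for i k c
  have eq: "e i k c \<longleftrightarrow> e j l c" for c using eq by (simp add: e_def)
  \<comment> \<open>These seven sets separate the twelve families.\<close>
  define T where "T i k = (e i k (\<lambda>n. n = 0), e i k (\<lambda>n. n = 1), e i k (\<lambda>n. n = 2), e i k (\<lambda>n. n = 3),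
    e i k (\<lambda>n. n = 0 \<or> n = 1), e i k (\<lambda>n. n = 0 \<or> n = 2), e i k (\<lambda>n. n = 0 \<or> n = 3))" for i k
  have "T i k = T j l" by (simp add: T_def eq)
  moreover have t: "T 0 None = (True, False, False, False, True, True, True)"
    "T 1 None = (False, True, False, False, True, False, False)"
    "T 2 None = (False, False, True, False, False, True, False)"
    "T 3 None = (False, False, False, True, False, False, True)"
    "T 0 (Some False) = (False, False, False, False, True, True, True)"
    "T 1 (Some False) = (False, False, False, False, True, False, False)"
    "T 2 (Some False) = (False, False, False, False, False, True, False)"
    "T 3 (Some False) = (False, False, False, False, False, False, True)"
    "T 0 (Some True) = (False, False, False, False, False, False, False)"
    "T 1 (Some True) = (False, False, False, False, False, True, True)"
    "T 2 (Some True) = (False, False, False, False, True, False, True)"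
    "T 3 (Some True) = (False, False, False, False, True, True, False)"
    by (simp_all add: T_def e_def)
  ultimately show ?thesis
    using x y unfolding carrier_model by (elim SigmaE2 insertE emptyE) (simp_all add: t)
qed

section \<open>Monotone self-dual Boolean functions of four variables\<close>

text \<open>The arguments of \<open>F\<close> are the membership bits of four points. An accepted
  singleton makes \<open>F\<close> principal. Otherwise all triples are accepted, and the three
  splittings into two pairs can be decided in eight ways.\<close>

lemma self_dual_function_cases:
  fixes F :: "bool \<Rightarrow> bool \<Rightarrow> bool \<Rightarrow> bool \<Rightarrow> bool"
  assumes mono: "\<And>p q r s p' q' r' s'. F p q r s \<Longrightarrow>
      p \<le> p' \<Longrightarrow> q \<le> q' \<Longrightarrow> r \<le> r' \<Longrightarrow> s \<le> s' \<Longrightarrow> F p' q' r' s'"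
    and dual: "\<And>p q r s. F (\<not> p) (\<not> q) (\<not> r) (\<not> s) \<longleftrightarrow> \<not> F p q r s"
  obtains i k where "i \<in> {0, 1, 2, 3 :: int}"
    "\<And>a. F (a 0) (a 1) (a 2) (a 3) \<longleftrightarrow> template k (\<lambda>m. a ((i + m) mod 4))"
proof -
  define A B C D where "A = F True False False False" and "B = F False True False False"
    and "C = F False False True False" and "D = F False False False True"
  define P Q R where "P = F True True False False" and "Q = F True False True False"
    and "R = F True False False True"
  note defs = A_def B_def C_def D_def P_def Q_def R_def
  have complements: "F False True True True \<longleftrightarrow> \<not> A" "F True False True True \<longleftrightarrow> \<not> B"
    "F True True False True \<longleftrightarrow> \<not> C" "F True True True False \<longleftrightarrow> \<not> D"
    "F False False True True \<longleftrightarrow> \<not> P" "F False True False True \<longleftrightarrow> \<not> Q"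
    "F False True True False \<longleftrightarrow> \<not> R"
    using dual[of True False False False] dual[of False True False False]
      dual[of False False True False] dual[of False False False True]
      dual[of True True False False] dual[of True False True False]
      dual[of True False False True]
    by (simp_all add: defs)
  have trivial: "F True True True True" "\<not> F False False False False"
    using dual[of True True True True] mono[of False False False False True True True True]
    by auto
  \<comment> \<open>All sixteen values in terms of the seven named ones.\<close>
  have expand: "F p q r s \<longleftrightarrow>
      (if p then
        (if q then (if r then s \<or> \<not> D else if s then \<not> C else P)
         else (if r then (if s then \<not> B else Q) else (if s then R else A)))
       else
        (if q then (if r then (if s then \<not> A else \<not> R) else if s then \<not> Q else B)
         else (if r then (if s then \<not> P else C) else s \<and> D)))" for p q r s
    by (cases p; cases q; cases r; cases s; simp add: trivial complements; simp add: defs)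
  \<comment> \<open>An accepted singleton forces all its supersets; for triples and complementary
    pairs this reads as a negation through \<open>complements\<close>. The exclusions left out of
    the later facts are contrapositives of the earlier ones.\<close>
  have le_A: "A \<Longrightarrow> P \<and> Q \<and> R \<and> \<not> B \<and> \<not> C \<and> \<not> D"
    using mono[of True False False False True True False False]
      mono[of True False False False True False True False]
      mono[of True False False False True False False True]
      mono[of True False False False True False True True]
      mono[of True False False False True True False True]
      mono[of True False False False True True True False]
    by (simp add: complements flip: defs)
  have le_B: "B \<Longrightarrow> P \<and> \<not> Q \<and> \<not> R \<and> \<not> C \<and> \<not> D"
    using mono[of False True False False True True False False]
      mono[of False True False False False True False True]
      mono[of False True False False False True True False]
      mono[of False True False False True True False True]
      mono[of False True False False True True True False]
    by (simp add: complements flip: defs)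
  have le_C: "C \<Longrightarrow> \<not> P \<and> Q \<and> \<not> R \<and> \<not> D"
    using mono[of False False True False False False True True]
      mono[of False False True False True False True False]
      mono[of False False True False False True True False]
      mono[of False False True False True True True False]
    by (simp add: complements flip: defs)
  have le_D: "D \<Longrightarrow> \<not> P \<and> \<not> Q \<and> R"
    using mono[of False False False True False False True True]
      mono[of False False False True False True False True]
      mono[of False False False True True False False True]
    by (simp add: complements flip: defs)
  consider "A" | "B" | "C" | "D"
    | (none) "\<not> A" "\<not> B" "\<not> C" "\<not> D" by blast
  then show thesis
  proof cases
    case 1
    with le_A show thesis by (intro that[of 0 None]) (simp_all add: expand)
  next
    case 2
    with le_A le_B le_C le_D show thesis by (intro that[of 1 None]) (auto simp: expand)
  next
    case 3
    with le_A le_B le_C le_D show thesis by (intro that[of 2 None]) (auto simp: expand)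
  next
    case 4
    with le_A le_B le_C le_D show thesis by (intro that[of 3 None]) (auto simp: expand)
  next
    case none
    \<comment> \<open>Accepted pairs are edges on four points, one from each perfect matching. They
      form a star at 0, 1, 2 or 3 (first row, \<open>Some False\<close>) or a triangle avoiding that
      point (second row, \<open>Some True\<close>).\<close>
    consider "P" "Q" "R" | "P" "\<not> Q" "\<not> R" | "\<not> P" "Q" "\<not> R" | "\<not> P" "\<not> Q" "R"
      | "\<not> P" "\<not> Q" "\<not> R" | "\<not> P" "Q" "R" | "P" "\<not> Q" "R" | "P" "Q" "\<not> R"
      by blast
    then show thesis
    proof cases
      case 1
      with none show thesis by (intro that[of 0 "Some False"]) (simp_all add: expand)
    next
      case 2
      with none show thesis by (intro that[of 1 "Some False"]) (auto simp: expand)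
    next
      case 3
      with none show thesis by (intro that[of 2 "Some False"]) (auto simp: expand)
    next
      case 4
      with none show thesis by (intro that[of 3 "Some False"]) (auto simp: expand)
    next
      case 5
      with none show thesis by (intro that[of 0 "Some True"]) (simp_all add: expand)
    next
      case 6
      with none show thesis by (intro that[of 1 "Some True"]) (auto simp: expand)
    next
      case 7
      with none show thesis by (intro that[of 2 "Some True"]) (auto simp: expand)
    next
      case 8
      with none show thesis by (intro that[of 3 "Some True"]) (auto simp: expand)
    qed
  qed
qed

section \<open>The templates and their translates as families of subsets of the group\<close>

locale cyclic_group_of_order_4 = group G for G (structure) +
  fixes g :: 'a
  assumes g [simp]: "g \<in> carrier G"
    and generates: "subgroup_generated G {g} = G"
    and order_4: "order G = 4"
begin

lemma pow_eq_iff: "g [^] (m :: int) = g [^] n \<longleftrightarrow> m mod 4 = n mod 4"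
proof -
  have "ord g = 4"
    using cyclic_order_is_ord[OF g] generates order_4 by simp
  then have "g [^] m = g [^] n \<longleftrightarrow> n mod 4 = m mod 4"
    by (simp add: int_pow_eq mod_eq_dvd_iff)
  then show ?thesis by auto
qed

lemma carrier_eq: "carrier G = range (\<lambda>n :: int. g [^] n)"
  using carrier_subgroup_generated_by_singleton[OF g] generates by simp

lemma pow_mod_in: "g [^] (n mod 4 :: int) \<in> A \<longleftrightarrow> g [^] n \<in> A"
proof -
  have "g [^] (n mod 4) = g [^] n" by (simp add: pow_eq_iff)
  then show ?thesis by simp
qed

text \<open>Testing \<open>g [^] (i + m)\<close> against \<open>A\<close> amounts to testing
  \<open>g [^] m\<close> against the translate of \<open>A\<close> by the inverse of
  \<open>g [^] i\<close>, so this is the translate of template \<open>k\<close> by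
  \<open>g [^] i\<close>.\<close>

definition family :: "int \<times> bool option \<Rightarrow> 'a set set" where
  "family = (\<lambda>(i, k). {A. A \<subseteq> carrier G \<and> template k (\<lambda>m. g [^] (i + m) \<in> A)})"

lemma family_superextension: "family x \<in> superextension (carrier G)"
proof -
  obtain i k where x: "x = (i, k)" by fastforce
  have "carrier G \<noteq> {}" using g by blast
  then show ?thesis
  proof (subst superextension_iff_self_dual, assumption, intro conjI allI impI)
    show "family x \<subseteq> Pow (carrier G)" by (auto simp: family_def x)
  next
    fix A B assume "A \<in> family x" "A \<subseteq> B" "B \<subseteq> carrier G"
    then show "B \<in> family x"
      by (auto simp: family_def x elim: template_mono)
  next
    fix A assume "A \<subseteq> carrier G"
    moreover have "template k (\<lambda>m. g [^] (i + m) \<in> carrier G - A) \<longleftrightarrow>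
        \<not> template k (\<lambda>m. g [^] (i + m) \<in> A)"
      using template_not[of k "\<lambda>m. g [^] (i + m) \<in> A"] by simp
    ultimately show "A \<in> family x \<longleftrightarrow> carrier G - A \<notin> family x"
      by (auto simp: family_def x)
  qed
qed

text \<open>By the product formula, membership of \<open>C\<close> is a nested template in the
  exponents \<open>(i + m) + (j + n)\<close>. Regrouped as \<open>(i + j) + (m + n)\<close>, it
  collapses by \<open>template_template\<close>.\<close>

lemma family_mult:
  "superextension_mult G (family (i, k)) (family (j, l)) =
    family ((i + j) mod 4, adjoin_mult k l)"
proof -
  have "{x \<in> carrier G. {y \<in> carrier G. x \<otimes> y \<in> C} \<in> family (j, l)} \<in> family (i, k) \<longleftrightarrow>
      template (adjoin_mult k l) (\<lambda>m. g [^] ((i + j) mod 4 + m) \<in> C)" for C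
  proof -
    let ?a = "\<lambda>n. g [^] (i + j + n) \<in> C"
    have "g [^] (i + m) \<otimes> g [^] (j + n) = g [^] (i + j + (m + n))" for m n :: int
      by (simp add: int_pow_mult[symmetric] add_ac)
    then have "{x \<in> carrier G. {y \<in> carrier G. x \<otimes> y \<in> C} \<in> family (j, l)} \<in> family (i, k) \<longleftrightarrow>
        template k (\<lambda>m. template l (\<lambda>n. ?a (m + n)))"
      by (simp add: family_def)
    also have "\<dots> \<longleftrightarrow> template (adjoin_mult k l) ?a"
    proof (rule template_template)
      show "?a (n + 4) \<longleftrightarrow> ?a n" for n
      proof -
        have "g [^] (i + j + (n + 4)) = g [^] (i + j + n)"
          unfolding pow_eq_iff by presburger
        then show ?thesis by simp
      qed
    qed
    also have "?a = (\<lambda>m. g [^] ((i + j) mod 4 + m) \<in> C)"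
    proof
      fix m
      have "g [^] (i + j + m) = g [^] ((i + j) mod 4 + m)"
        unfolding pow_eq_iff by presburger
      then show "?a m = (g [^] ((i + j) mod 4 + m) \<in> C)" by simp
    qed
    finally show ?thesis .
  qed
  moreover have "upfamily (carrier G) (family x)" for x
    using family_superextension[of x] by (simp add: superextension_def)
  ultimately have "superextension_mult G (family (i, k)) (family (j, l)) =
      {C. C \<subseteq> carrier G \<and> template (adjoin_mult k l) (\<lambda>m. g [^] ((i + j) mod 4 + m) \<in> C)}"
    by (simp add: superextension_mult_eq)
  then show ?thesis by (simp add: family_def)
qed

text \<open>Inverse to reading a subset as a sequence; \<open>c\<close> is consulted only at the
  residues 0 to 3.\<close>

definition pattern_set :: "(int \<Rightarrow> bool) \<Rightarrow> 'a set" where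
  "pattern_set c = {g [^] n | n :: int. c (n mod 4)}"

lemma pattern_set_subset: "pattern_set c \<subseteq> carrier G"
  by (auto simp: pattern_set_def)

lemma pow_in_pattern_set: "g [^] (n :: int) \<in> pattern_set c \<longleftrightarrow> c (n mod 4)"
  by (auto simp: pattern_set_def pow_eq_iff)

lemma pattern_set_not: "pattern_set (\<lambda>n. \<not> c n) = carrier G - pattern_set c"
  by (auto simp: carrier_eq pattern_set_def pow_eq_iff)

lemma pattern_set_of_set:
  "A \<subseteq> carrier G \<Longrightarrow> pattern_set (\<lambda>n. g [^] n \<in> A) = A"
  by (auto simp: pattern_set_def pow_mod_in carrier_eq)

lemma inj_on_family: "inj_on family (carrier model)"
proof (rule inj_onI)
  fix x y assume xy: "x \<in> carrier model" "y \<in> carrier model" "family x = family y"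
  obtain i k j l where x: "x = (i, k)" and y: "y = (j, l)" by fastforce
  have eq: "template k (\<lambda>m. c ((i + m) mod 4)) \<longleftrightarrow> template l (\<lambda>m. c ((j + m) mod 4))" for c
  proof -
    have "pattern_set c \<in> family x \<longleftrightarrow> pattern_set c \<in> family y" using xy(3) by simp
    then show ?thesis by (simp add: family_def x y pattern_set_subset pow_in_pattern_set)
  qed
  show "x = y"
    using template_inject[OF xy(1,2)[unfolded x y] eq] by (simp add: x y)
qed

text \<open>A maximal linked upfamily becomes a Boolean function of four membership bits. Its
  closure under supersets makes the function monotone and its complement rule makes it self-dual, so
  the classification applies.\<close>

lemma superextension_subset_family: "superextension (carrier G) \<subseteq> family ` carrier model"
proof
  fix L assume L: "L \<in> superextension (carrier G)"
  have "carrier G \<noteq> {}" using g by blast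
  with L have sub: "L \<subseteq> Pow (carrier G)"
    and up: "\<And>A B. A \<in> L \<Longrightarrow> A \<subseteq> B \<Longrightarrow> B \<subseteq> carrier G \<Longrightarrow> B \<in> L"
    and dual: "\<And>A. A \<subseteq> carrier G \<Longrightarrow> A \<in> L \<longleftrightarrow> carrier G - A \<notin> L"
    unfolding superextension_iff_self_dual[OF \<open>carrier G \<noteq> {}\<close>] by blast+
  \<comment> \<open>The last branch serves the residue 3; its values at other integers do not enter
    \<open>pattern_set\<close>.\<close>
  define v :: "bool \<Rightarrow> bool \<Rightarrow> bool \<Rightarrow> bool \<Rightarrow> int \<Rightarrow> bool"
    where "v p q r s n = (if n = 0 then p else if n = 1 then q else if n = 2 then r else s)"
      for p q r s n
  define F where "F p q r s \<longleftrightarrow> pattern_set (v p q r s) \<in> L" for p q r s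
  have mono: "F p' q' r' s'"
    if F: "F p q r s" and le: "p \<le> p'" "q \<le> q'" "r \<le> r'" "s \<le> s'" for p q r s p' q' r' s'
  proof -
    have "v p' q' r' s' n" if "v p q r s n" for n
      using le that by (auto simp: v_def split: if_splits)
    then have "pattern_set (v p q r s) \<subseteq> pattern_set (v p' q' r' s')"
      unfolding pattern_set_def by blast
    then show ?thesis
      using up[OF F[unfolded F_def] _ pattern_set_subset] by (simp add: F_def)
  qed
  have F_dual: "F (\<not> p) (\<not> q) (\<not> r) (\<not> s) \<longleftrightarrow> \<not> F p q r s" for p q r s
  proof -
    have "v (\<not> p) (\<not> q) (\<not> r) (\<not> s) = (\<lambda>n. \<not> v p q r s n)"
      by (simp add: v_def fun_eq_iff)
    then show ?thesis
      using dual[OF pattern_set_subset, of "v p q r s"] by (simp add: F_def pattern_set_not)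
  qed
  obtain i k where i: "i \<in> {0, 1, 2, 3 :: int}"
    and F: "\<And>a. F (a 0) (a 1) (a 2) (a 3) \<longleftrightarrow> template k (\<lambda>m. a ((i + m) mod 4))"
  proof (rule self_dual_function_cases[of F])
    show "F p' q' r' s'"
      if "F p q r s" "p \<le> p'" "q \<le> q'" "r \<le> r'" "s \<le> s'" for p q r s p' q' r' s'
      using that by (rule mono)
    show "F (\<not> p) (\<not> q) (\<not> r) (\<not> s) \<longleftrightarrow> \<not> F p q r s" for p q r s
      by (rule F_dual)
  qed (rule that)
  have "A \<in> L \<longleftrightarrow> A \<in> family (i, k)" if A: "A \<subseteq> carrier G" for A
  proof -
    let ?a = "\<lambda>n :: int. g [^] n \<in> A"
    have "pattern_set (v (?a 0) (?a 1) (?a 2) (?a 3)) = pattern_set ?a"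
    proof -
      have "v (?a 0) (?a 1) (?a 2) (?a 3) (n mod 4) \<longleftrightarrow> ?a (n mod 4)" for n
      proof -
        consider "n mod 4 = 0" | "n mod 4 = 1" | "n mod 4 = 2" | "n mod 4 = 3" by linarith
        then show ?thesis by cases (simp_all add: v_def)
      qed
      then show ?thesis by (simp add: pattern_set_def)
    qed
    then have "A \<in> L \<longleftrightarrow> F (?a 0) (?a 1) (?a 2) (?a 3)"
      using pattern_set_of_set[OF A] by (simp add: F_def)
    also have "\<dots> \<longleftrightarrow> template k (\<lambda>m. g [^] (i + m) \<in> A)"
      using F[of ?a] by (simp only: pow_mod_in)
    finally show ?thesis using A by (simp add: family_def)
  qed
  then have "L = family (i, k)"
    using sub by (auto simp: family_def)
  moreover have "(i, k) \<in> carrier model"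
    using i by (auto simp: model_def)
  ultimately show "L \<in> family ` carrier model" by blast
qed

lemma family_iso: "family \<in> iso model (superextension_semigroup G)"
  unfolding iso_def
proof (intro CollectI conjI homI)
  show "bij_betw family (carrier model) (carrier (superextension_semigroup G))"
    unfolding bij_betw_def superextension_semigroup_def
    using inj_on_family superextension_subset_family family_superextension by auto
next
  fix x y assume "x \<in> carrier model" "y \<in> carrier model"
  show "family (x \<otimes>\<^bsub>model\<^esub> y) = family x \<otimes>\<^bsub>superextension_semigroup G\<^esub> family y"
    by (cases x; cases y) (simp add: mult_model superextension_semigroup_def family_mult)
qed (simp add: superextension_semigroup_def family_superextension)

end

theorem mainTheorem6:
  fixes C4 :: "'a monoid"
  assumes "group C4" and "cyclic_group C4" and "order C4 = 4"
  shows "AutoGroup (superextension_semigroup C4) \<cong> integer_mod_group 2 \<times>\<times> integer_mod_group 2"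
proof -
  obtain g where "g \<in> carrier C4" "subgroup_generated C4 {g} = C4"
    using assms(2) by (auto simp: cyclic_group_def)
  then interpret cyclic_group_of_order_4 C4 g
    using assms by (simp add: cyclic_group_of_order_4_def cyclic_group_of_order_4_axioms_def)
  have "x \<otimes>\<^bsub>model\<^esub> y \<in> carrier model" for x y
    by (cases x; cases y) (simp add: model_def)
  \<comment> \<open>The chain starts from the direct product because reversing an isomorphism uses
    that its source is a group.\<close>
  then have "integer_mod_group 2 \<times>\<times> integer_mod_group 2 \<cong> AutoGroup (superextension_semigroup C4)"
    using AutoGroup_model AutoGroup_iso[OF family_iso] iso_trans by blast
  then show ?thesis
    by (simp add: group.iso_sym DirProd_group)
qed

end
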